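(* Let $\mathcal{G}$ be a simple undirected graph on $n$ nodes with combinatorial Laplacian $L=D-G$, let $\mathbf{c},\mathbf{x}_0\in\mathbb{R}^n$ be arbitrary, and let $\tau>0$. Consider the continuous-time system $\dot{\mathbf{x}}(t)=-L\mathbf{x}(t)$, $\mathbf{x}(0)=\mathbf{x}_0$, $y(t)=\mathbf{c}^{\intercal}\mathbf{x}(t)$, and its samples $y_k=y(k\tau)$, $k=0,\ldots,2n-1$. Let $r$ be the rank of the $n\times n$ Hankel matrix with entries $y_{i+j}$, $0\le i,j\le n-1$. Then every element $e^{-\lambda_i\tau}$ of the support $\mathcal{S}_{\mu_L}$ is a root of the polynomial $p_L(x)=x^{r}+\alpha_{r-1}x^{r-1}+\cdots+\alpha_1x+\alpha_0$, where $$\begin{bmatrix}\alpha_0\\ \alpha_1\\ \vdots\\ \alpha_{r-1}\end{bmatrix}=-\begin{bmatrix} y_0&y_1&\cdots&y_{r-1}\\ y_1&y_2&\cdots&y_r\\ \vdots&\vdots&\ddots&\vdots\\ y_{r-1}&y_r&\cdots&y_{2r-2}\end{bmatrix}^{-1}\begin{bmatrix}y_r\\ y_{r+1}\\ \vdots\\ y_{2r-1}\end{bmatrix}$$ (the $r\times r$ matrix here being invertible), and the corresponding eigenvalue of $L$ is recovered from the element $z=e^{-\lambda_i\tau}\in\mathcal{S}_{\mu_L}$ as $\lambda_i=-\tfrac{1}{\tau}\log z$.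
   Context: $G$ is the adjacency matrix of $\mathcal{G}$ and $D$ the diagonal matrix of node degrees. The symmetric matrix $L$ is diagonalized as $L=U\Lambda W$ with $\Lambda=\mathrm{diag}(\lambda_1,\ldots,\lambda_n)$ (real eigenvalues listed with multiplicity), $U=[\mathbf{u}_1,\ldots,\mathbf{u}_n]$ orthogonal, and $W=U^{\intercal}=U^{-1}$ with rows $\mathbf{w}_1^{\intercal},\ldots,\mathbf{w}_n^{\intercal}$. The weights are $\omega_i=\mathbf{c}^{\intercal}\mathbf{u}_i\mathbf{w}_i^{\intercal}\mathbf{x}_0$. The signed measure $\mu_L=\sum_{i=1}^n\omega_i\delta(z-e^{-\lambda_i\tau})$ on $\mathbb{R}$ has support $$\mathcal{S}_{\mu_L}=\Big\{e^{-\lambda_i\tau} : \sum_{j:\lambda_j=\lambda_i}\omega_j\neq 0\Big\}.$$ If $r=0$, the polynomial $p_L$ is the constant $1$. *)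

theory Defs
  imports
    Complex_Main
    "HOL-Computational_Algebra.Polynomial"
    "Graph_Theory.Digraph"
    "Jordan_Normal_Form.Matrix"
    "Jordan_Normal_Form.Gauss_Jordan_Elimination"
    "Jordan_Normal_Form.Char_Poly"
    "Jordan_Normal_Form.DL_Rank"
begin

text \<open>
  Simple undirected graphs are the locale \<open>graph\<close>: finite, loop-free, symmetric digraphs
  without parallel arcs, each undirected edge being a pair of opposite arcs. Hence
  \<open>out_degree\<close> is the usual node degree. Nodes are \<open>0, \<dots>, n - 1\<close>.
\<close>

definition adjacency_mat :: "nat \<Rightarrow> (nat, 'e) pre_digraph \<Rightarrow> real mat" where
  "adjacency_mat n G = mat n n (\<lambda>(i, j). if (i, j) \<in> arcs_ends G then 1 else 0)"

definition degree_mat :: "nat \<Rightarrow> (nat, 'e) pre_digraph \<Rightarrow> real mat" where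
  "degree_mat n G = mat_diag n (\<lambda>i. real (out_degree G i))"

definition laplacian_mat :: "nat \<Rightarrow> (nat, 'e) pre_digraph \<Rightarrow> real mat" where
  "laplacian_mat n G = degree_mat n G - adjacency_mat n G"

text \<open>
  Since \<open>real vec\<close> is not a normed space, the derivative is taken componentwise. At
  \<open>t = 0\<close> it is the one-sided derivative.
\<close>

definition solves_linear_ode :: "nat \<Rightarrow> real mat \<Rightarrow> real vec \<Rightarrow> (real \<Rightarrow> real vec) \<Rightarrow> bool" where
  "solves_linear_ode n A x0 x \<longleftrightarrow>
     (\<forall>t\<ge>0. x t \<in> carrier_vec n) \<and> x 0 = x0 \<and>
     (\<forall>t\<ge>0. \<forall>i<n. ((\<lambda>s. x s $ i) has_real_derivative (A *\<^sub>v x t) $ i) (at t within {0..}))"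

definition spectral_weight ::
  "real vec \<Rightarrow> real mat \<Rightarrow> real mat \<Rightarrow> real vec \<Rightarrow> nat \<Rightarrow> real" where
  "spectral_weight c U W x0 i = (c \<bullet> col U i) * (row W i \<bullet> x0)"

text \<open>The support of the signed measure with mass \<open>\<omega> i\<close> at the point \<open>exp (- \<lambda> i * \<tau>)\<close>, \<open>i < n\<close>.\<close>

definition spectral_support :: "nat \<Rightarrow> (nat \<Rightarrow> real) \<Rightarrow> (nat \<Rightarrow> real) \<Rightarrow> real \<Rightarrow> real set" where
  "spectral_support n ev \<omega> \<tau> =
     {exp (- ev i * \<tau>) | i. i < n \<and> (\<Sum>j | j < n \<and> ev j = ev i. \<omega> j) \<noteq> 0}"

definition hankel_mat :: "nat \<Rightarrow> (nat \<Rightarrow> real) \<Rightarrow> real mat" where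
  "hankel_mat m y = mat m m (\<lambda>(i, j). y (i + j))"

text \<open>
  \<open>mat_inverse\<close> returns \<open>Some\<close> inverse exactly on invertible matrices, so the following
  vector is meaningful only if \<open>hankel_mat r y\<close> is invertible.
\<close>

definition hankel_coeffs :: "nat \<Rightarrow> (nat \<Rightarrow> real) \<Rightarrow> real vec" where
  "hankel_coeffs r y = - (the (mat_inverse (hankel_mat r y)) *\<^sub>v vec r (\<lambda>i. y (r + i)))"

definition hankel_poly :: "nat \<Rightarrow> (nat \<Rightarrow> real) \<Rightarrow> real poly" where
  "hankel_poly r y = monom 1 r + (\<Sum>i<r. monom (hankel_coeffs r y $ i) i)"

end

theory Submission
  imports Defs "Jordan_Normal_Form.DL_Rank_Submatrix"
begin

text \<open>
  The samples are the moments \<open>y\<^sub>k = (\<Sum>z\<in>S. m z * z ^ k)\<close> of a measure with finite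
  support \<open>S\<close> and nonvanishing masses. The Hankel matrix is then a sum of \<open>card S\<close> matrices of
  rank one, and applying its leading \<open>card S \<times> card S\<close> block to the coefficient vector of a
  polynomial \<open>p\<close> yields the numbers \<open>\<Sum>z\<in>S. m z * z ^ i * p z\<close>. If these vanish for all
  \<open>i < card S\<close>, pairing with the Lagrange polynomials of \<open>S\<close> shows that \<open>p\<close> vanishes on \<open>S\<close>.
  For \<open>p\<close> of degree less than \<open>card S\<close> this makes the block invertible, so that the rank is
  \<open>card S\<close>; for the polynomial defined by the linear system it is the claim on the roots.
\<close>

section \<open>Moments and the leading Hankel block\<close>

lemma vanishing_moments_imp_roots:
  fixes m :: "'a :: field \<Rightarrow> 'a"
  assumes S: "finite S" "z \<in> S" and m: "m z \<noteq> 0"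
    and moments: "\<And>i. i < card S \<Longrightarrow> (\<Sum>x\<in>S. m x * x ^ i * poly p x) = 0"
  shows "poly p z = 0"
proof -
  \<comment> \<open>This is the Lagrange polynomial of \<open>S\<close> at \<open>z\<close> without
    its normalizing factor; only \<open>poly q z \<noteq> 0\<close> matters. Its degree
    \<open>card S - 1\<close> keeps it within the range of \<open>moments\<close>.\<close>
  define q where "q = (\<Prod>w\<in>S - {z}. [:- w, 1:])"
  have "degree q = (\<Sum>w\<in>S - {z}. degree [:- w, 1:])"
    unfolding q_def by (rule degree_prod_eq_sum_degree) auto
  also have "\<dots> = card S - 1"
    using S by simp
  finally have deg: "degree q < card S"
    using S card_gt_0_iff[of S] by auto
  have q_root: "poly q x = 0" if "x \<in> S" "x \<noteq> z" for x
    using that S by (auto simp: q_def poly_prod intro!: prod_zero bexI[of _ x])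
  have q_z: "poly q z \<noteq> 0"
    using S by (auto simp: q_def poly_prod)
  have "m z * poly q z * poly p z = (\<Sum>x\<in>{z}. m x * poly q x * poly p x)"
    by simp
  also have "\<dots> = (\<Sum>x\<in>S. m x * poly q x * poly p x)"
    using S q_root by (intro sum.mono_neutral_left) auto
  also have "\<dots> = (\<Sum>x\<in>S. \<Sum>i\<le>degree q. coeff q i * (m x * x ^ i * poly p x))"
    unfolding poly_altdef[of q] by (simp add: sum_distrib_left sum_distrib_right mult_ac)
  also have "\<dots> = (\<Sum>i\<le>degree q. coeff q i * (\<Sum>x\<in>S. m x * x ^ i * poly p x))"
    by (subst sum.swap) (simp add: sum_distrib_left)
  also have "\<dots> = 0"
    using moments deg by (intro sum.neutral) auto
  finally show ?thesis
    using m q_z by simp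
qed

lemma hankel_mat_carrier [simp]: "hankel_mat r y \<in> carrier_mat r r"
  by (simp add: hankel_mat_def)

lemma poly_sum_monom:
  fixes x :: "'a :: comm_semiring_1"
  shows "poly (\<Sum>j<r. monom (f j) j) x = (\<Sum>j<r. f j * x ^ j)"
  by (simp add: poly_sum poly_monom)

text \<open>This is the factorization of the block as \<open>V^T diag(m) V\<close> with
  \<open>V\<close> the Vandermonde matrix of \<open>S\<close>: \<open>V\<close> evaluates the
  polynomial with coefficients \<open>v\<close> on \<open>S\<close>.\<close>

lemma hankel_mat_mult_vec_moments:
  assumes y: "\<And>k. k < 2 * r \<Longrightarrow> y k = (\<Sum>z\<in>S. m z * z ^ k)"
    and v: "v \<in> carrier_vec r" and i: "i < r"
  shows "(hankel_mat r y *\<^sub>v v) $ i = (\<Sum>z\<in>S. m z * z ^ i * poly (\<Sum>j<r. monom (v $ j) j) z)"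
proof -
  have "(hankel_mat r y *\<^sub>v v) $ i = (\<Sum>j<r. y (i + j) * v $ j)"
    using v i by (auto simp: hankel_mat_def scalar_prod_def atLeast0LessThan intro!: sum.cong)
  also have "\<dots> = (\<Sum>j<r. \<Sum>z\<in>S. m z * z ^ i * (v $ j * z ^ j))"
    using i by (intro sum.cong) (auto simp: y sum_distrib_left sum_distrib_right power_add mult_ac)
  also have "\<dots> = (\<Sum>z\<in>S. m z * z ^ i * poly (\<Sum>j<r. monom (v $ j) j) z)"
    by (subst sum.swap) (simp add: poly_sum_monom sum_distrib_left)
  finally show ?thesis .
qed

lemma det_hankel_mat_moments_nonzero:
  assumes S: "finite S" and m: "\<And>z. z \<in> S \<Longrightarrow> m z \<noteq> 0"
    and y: "\<And>k. k < 2 * card S \<Longrightarrow> y k = (\<Sum>z\<in>S. m z * z ^ k)"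
  shows "det (hankel_mat (card S) y) \<noteq> 0"
proof
  assume "det (hankel_mat (card S) y) = 0"
  then obtain v where v: "v \<in> carrier_vec (card S)" "v \<noteq> 0\<^sub>v (card S)"
      and Hv: "hankel_mat (card S) y *\<^sub>v v = 0\<^sub>v (card S)"
    using det_0_iff_vec_prod_zero_field[OF hankel_mat_carrier] by blast
  define p where "p = (\<Sum>j<card S. monom (v $ j) j)"
  have coeff_p: "coeff p j = (if j < card S then v $ j else 0)" for j
    by (simp add: p_def coeff_sum)
  have moments: "(\<Sum>x\<in>S. m x * x ^ i * poly p x) = 0" if "i < card S" for i
    using hankel_mat_mult_vec_moments[OF y v(1) that] Hv that by (simp add: p_def)
  have root: "poly p z = 0" if "z \<in> S" for z
    using vanishing_moments_imp_roots[OF S that m[OF that] moments] .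
  have "p \<noteq> 0"
  proof
    assume "p = 0"
    then have "v $ j = 0" if "j < card S" for j
      using coeff_p[of j] that by simp
    with v show False
      by (auto intro!: eq_vecI)
  qed
  then have "card S \<le> card {z. poly p z = 0}"
    using root poly_roots_finite by (intro card_mono) auto
  also have "\<dots> \<le> degree p"
    using \<open>p \<noteq> 0\<close> by (rule card_poly_roots_bound)
  \<comment> \<open>The root count forces \<open>degree p\<close> to be at least
    \<open>card S\<close>, where \<open>p\<close> has no coefficients.\<close>
  finally have "coeff p (degree p) = 0"
    by (simp add: coeff_p)
  with \<open>p \<noteq> 0\<close> show False
    by simp
qed

section \<open>Rank of the Hankel matrix\<close>

lemma rank_sum_rank_one_le:
  fixes f g :: "'b \<Rightarrow> nat \<Rightarrow> 'a :: field"
  assumes "finite S"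
  shows "vec_space.rank n (mat n nc (\<lambda>(i, j). \<Sum>s\<in>S. f s i * g s j)) \<le> card S"
  using assms
proof (induction S rule: finite_induct)
  case empty
  have "mat n nc (\<lambda>(i, j). \<Sum>s\<in>{}. f s i * g s j) = 0\<^sub>m n nc"
    by (rule eq_matI) auto
  then show ?case
    by (simp only: vec_space.rank_0I)
next
  case (insert s S)
  let ?A = "mat n nc (\<lambda>(i, j). f s i * g s j)"
  let ?B = "mat n nc (\<lambda>(i, j). \<Sum>s\<in>S. f s i * g s j)"
  have eq: "mat n nc (\<lambda>(i, j). \<Sum>s\<in>insert s S. f s i * g s j) = ?A + ?B"
    using insert by (intro eq_matI) auto
  have "vec_space.rank n (?A + ?B) \<le> vec_space.rank n ?A + vec_space.rank n ?B"
    by (rule vec_space.rank_subadditive[where nc = nc]) auto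
  moreover have "vec_space.rank n ?A \<le> 1"
    by (rule vec_space.rank_le_1_product_entries[where f = "f s" and g = "g s" and nc = nc]) auto
  ultimately show ?case
    using insert unfolding eq by simp
qed

lemma submatrix_hankel_mat:
  assumes "r \<le> n"
  shows "submatrix (hankel_mat n y) {..<r} {..<r} = hankel_mat r y"
proof -
  have *: "{i. i < n \<and> i < r} = {..<r}"
    using assms by auto
  \<comment> \<open>\<open>pick\<close> enumerates an index set in increasing order, and
    \<open>i\<close> has exactly \<open>i\<close> predecessors in an initial segment.\<close>
  have pick: "pick {..<r} i = i" if "i < r" for i
  proof -
    have "{a \<in> {..<r}. a < i} = {..<i}"
      using that by auto
    then show ?thesis
      using pick_card_in_set[of i "{..<r}"] that by simp
  qed
  show ?thesis
    using assms by (intro eq_matI) (auto simp: submatrix_def hankel_mat_def * pick)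
qed

text \<open>The upper bound comes from one rank-one summand per point of \<open>S\<close>, the lower
  bound from the nonzero leading minor of size \<open>card S\<close>. Thus the rank counts the
  atoms.\<close>

lemma rank_hankel_mat_moments:
  assumes S: "finite S" "card S \<le> n" and m: "\<And>z. z \<in> S \<Longrightarrow> m z \<noteq> 0"
    and y: "\<And>k. k < 2 * n \<Longrightarrow> y k = (\<Sum>z\<in>S. m z * z ^ k)"
  shows "vec_space.rank n (hankel_mat n y) = card S"
proof (rule antisym)
  have "hankel_mat n y = mat n n (\<lambda>(i, j). \<Sum>z\<in>S. (m z * z ^ i) * z ^ j)"
    by (rule eq_matI) (auto simp: hankel_mat_def y power_add mult_ac)
  then show "vec_space.rank n (hankel_mat n y) \<le> card S"
    using rank_sum_rank_one_le[OF S(1), of n n "\<lambda>z i. m z * z ^ i" "\<lambda>z j. z ^ j"] by simp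
  have "det (submatrix (hankel_mat n y) {..<card S} {..<card S}) \<noteq> 0"
    unfolding submatrix_hankel_mat[OF S(2)]
    using S by (intro det_hankel_mat_moments_nonzero[where m = m] m y) auto
  then have "card {j. j < n \<and> j \<in> {..<card S}} \<le> vec_space.rank n (hankel_mat n y)"
    by (intro vec_space.rank_gt_minor[OF hankel_mat_carrier])
  moreover have "{j. j < n \<and> j \<in> {..<card S}} = {..<card S}"
    using S by auto
  ultimately show "card S \<le> vec_space.rank n (hankel_mat n y)"
    by simp
qed

section \<open>The polynomial defined by the linear system\<close>

text \<open>Excluding \<open>None\<close> makes \<open>the (mat_inverse _)\<close> in
  \<open>hankel_coeffs\<close> a genuine inverse.\<close>

lemma det_nonzero_mat_inverse:
  fixes A :: "'a :: field mat"
  assumes A: "A \<in> carrier_mat n n" and "det A \<noteq> 0"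
  obtains B where "mat_inverse A = Some B" "A * B = 1\<^sub>m n" "B * A = 1\<^sub>m n" "B \<in> carrier_mat n n"
proof -
  have "mat_inverse A \<noteq> None"
    \<comment> \<open>The value \<open>()\<close> only fills the extension slot of the record
      \<open>ring_mat\<close>, so that both facts speak of the same ring.\<close>
    using mat_inverse(1)[OF A, where b = "()"] det_non_zero_imp_unit[OF A assms(2), of "()"] by blast
  then obtain B where "mat_inverse A = Some B"
    by auto
  with mat_inverse(2)[OF A this] that show ?thesis
    by blast
qed

text \<open>The linear system for the coefficients says exactly that the polynomial is orthogonal to
  \<open>x ^ i\<close>, \<open>i < card S\<close>, with respect to the masses
  \<open>m\<close>.\<close>

lemma hankel_poly_moments_root:
  assumes S: "finite S" and m: "\<And>z. z \<in> S \<Longrightarrow> m z \<noteq> 0"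
    and y: "\<And>k. k < 2 * card S \<Longrightarrow> y k = (\<Sum>z\<in>S. m z * z ^ k)"
    and z: "z \<in> S"
  shows "poly (hankel_poly (card S) y) z = 0"
proof -
  let ?r = "card S"
  let ?H = "hankel_mat ?r y" and ?a = "hankel_coeffs ?r y" and ?b = "vec ?r (\<lambda>i. y (?r + i))"
  obtain B where B: "mat_inverse ?H = Some B" "?H * B = 1\<^sub>m ?r" "B \<in> carrier_mat ?r ?r"
    using det_nonzero_mat_inverse[OF hankel_mat_carrier det_hankel_mat_moments_nonzero[OF S m y]]
    by metis
  have a: "?a = - (B *\<^sub>v ?b)"
    by (simp add: hankel_coeffs_def B)
  then have a_carrier: "?a \<in> carrier_vec ?r"
    using B by simp
  have "?H *\<^sub>v ?a = - (?H *\<^sub>v (B *\<^sub>v ?b))"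
    unfolding a using B by (intro eq_vecI) (auto simp: hankel_mat_def)
  also have "?H *\<^sub>v (B *\<^sub>v ?b) = (?H * B) *\<^sub>v ?b"
    by (rule assoc_mult_mat_vec[symmetric, OF hankel_mat_carrier B(3)]) simp
  also have "\<dots> = ?b"
    unfolding B(2) by simp
  finally have Ha: "?H *\<^sub>v ?a = - ?b" .
  have moments: "(\<Sum>x\<in>S. m x * x ^ i * poly (hankel_poly ?r y) x) = 0" if i: "i < ?r" for i
  proof -
    \<comment> \<open>The leading monomial contributes \<open>y (?r + i)\<close>, the lower terms
      row \<open>i\<close> of \<open>?H *\<^sub>v ?a\<close>; the system makes them cancel.\<close>
    have "(\<Sum>x\<in>S. m x * x ^ i * poly (hankel_poly ?r y) x) =
        (\<Sum>x\<in>S. m x * x ^ (?r + i)) + (?H *\<^sub>v ?a) $ i"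
      by (simp add: hankel_mat_mult_vec_moments[OF y a_carrier i] hankel_poly_def poly_monom
          algebra_simps sum.distrib power_add del: index_mult_mat_vec)
    also have "\<dots> = 0"
      using i unfolding Ha by (simp add: y)
    finally show ?thesis .
  qed
  show ?thesis
    using vanishing_moments_imp_roots[OF S z m[OF z] moments] .
qed

section \<open>Solution of the differential equation in eigencoordinates\<close>

lemma scalar_exponential_ode:
  fixes f :: "real \<Rightarrow> real"
  assumes f: "\<And>t. t \<ge> 0 \<Longrightarrow> (f has_real_derivative a * f t) (at t within {0..})" and t: "t \<ge> 0"
  shows "f t = exp (a * t) * f 0"
proof -
  \<comment> \<open>The integrating factor turns the equation into \<open>?g' = 0\<close>.\<close>
  let ?g = "\<lambda>s. exp (- a * s) * f s"
  have g: "(?g has_real_derivative 0) (at s within {0..})" if "s \<ge> 0" for s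
    by (rule derivative_eq_intros f that refl | simp)+
  have "?g t = ?g 0"
  proof (cases "t = 0")
    case False
    show ?thesis
    proof (rule DERIV_isconst_end[where f = ?g])
      show "0 < t"
        using t False by simp
      have "continuous_on {0..} ?g"
        using g by (intro DERIV_continuous_on) auto
      then show "continuous_on {0..t} ?g"
        by (rule continuous_on_subset) auto
      show "(?g has_real_derivative 0) (at s)" if "0 < s" "s < t" for s
      proof -
        \<comment> \<open>Away from the endpoint the one-sided derivative is two-sided, since
          \<open>{0<..}\<close> is an open neighbourhood of \<open>s\<close>.\<close>
        have "(?g has_real_derivative 0) (at s within {0<..})"
          using that by (intro DERIV_subset[OF g]) auto
        then show ?thesis
          using that at_within_open[of s "{0<..}"] by simp
      qed
    qed
  qed simp
  then show ?thesis
    by (simp add: exp_minus field_simps)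
qed

text \<open>The coordinates \<open>row W i \<bullet> x t\<close> decouple into scalar equations;
  expanding \<open>x t = U *\<^sub>v (W *\<^sub>v x t)\<close> then yields the modal sum.\<close>

lemma diagonalized_ode_solution:
  assumes U: "U \<in> carrier_mat n n" and W: "W \<in> carrier_mat n n"
    and UW: "U * W = 1\<^sub>m n" and WU: "W * U = 1\<^sub>m n"
    and x: "solves_linear_ode n (- (U * mat_diag n ev * W)) x0 x"
    and c: "c \<in> carrier_vec n" and t: "t \<ge> 0"
  shows "c \<bullet> x t = (\<Sum>i<n. spectral_weight c U W x0 i * exp (- ev i * t))"
proof -
  let ?D = "mat_diag n ev"
  let ?A = "U * ?D * W"
  have D: "?D \<in> carrier_mat n n"
    by simp
  have A: "?A \<in> carrier_mat n n"
    using mult_carrier_mat[OF mult_carrier_mat[OF U D] W] .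
  have xc: "x s \<in> carrier_vec n" if "s \<ge> 0" for s
    using x that by (simp add: solves_linear_ode_def)
  have x_deriv: "((\<lambda>s. x s $ i) has_real_derivative (- ?A *\<^sub>v x s) $ i) (at s within {0..})"
    if "s \<ge> 0" "i < n" for s i
    using x that by (simp add: solves_linear_ode_def)
  have "W * ?A = (W * U) * (?D * W)"
    using assoc_mult_mat[OF U D W] assoc_mult_mat[OF W U mult_carrier_mat[OF D W]] by simp
  \<comment> \<open>The rows of \<open>W\<close> are left eigenvectors.\<close>
  then have WA: "W * ?A = ?D * W"
    using W D WU by simp
  have mode: "row W i \<bullet> x s = exp (- ev i * s) * (row W i \<bullet> x 0)" if i: "i < n" and s: "s \<ge> 0" for i s
  proof -
    let ?f = "\<lambda>s. \<Sum>j<n. W $$ (i, j) * x s $ j"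
    have f: "row W i \<bullet> x u = ?f u" if "u \<ge> 0" for u
      using xc[OF that] W i by (auto simp: scalar_prod_def atLeast0LessThan intro!: sum.cong)
    have "(?f has_real_derivative - ev i * ?f u) (at u within {0..})" if u: "u \<ge> 0" for u
    proof -
      have "(?f has_real_derivative (\<Sum>j<n. W $$ (i, j) * (- ?A *\<^sub>v x u) $ j)) (at u within {0..})"
        using u by (intro DERIV_sum DERIV_cmult x_deriv) auto
      also have "(\<Sum>j<n. W $$ (i, j) * (- ?A *\<^sub>v x u) $ j) = - (W *\<^sub>v (?A *\<^sub>v x u)) $ i"
        using W U i xc[OF u]
        by (simp add: scalar_prod_def[of "row W i"] atLeast0LessThan sum_negf)
      also have "W *\<^sub>v (?A *\<^sub>v x u) = mat n n (\<lambda>(i, j). ev i * W $$ (i, j)) *\<^sub>v x u"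
        using assoc_mult_mat_vec[OF W A xc[OF u]] WA mat_diag_mult_left[OF W, of ev] by simp
      also have "\<dots> $ i = ev i * ?f u"
        using i xc[OF u] by (simp add: scalar_prod_def atLeast0LessThan sum_distrib_left mult_ac)
      finally show ?thesis
        by simp
    qed
    from scalar_exponential_ode[OF this s] show ?thesis
      by (simp add: f s)
  qed
  have x0: "x 0 = x0"
    using x by (simp add: solves_linear_ode_def)
  have "x t = U *\<^sub>v (W *\<^sub>v x t)"
    using assoc_mult_mat_vec[OF U W xc[OF t]] UW xc[OF t] by simp
  then have "c \<bullet> x t = c \<bullet> (U *\<^sub>v (W *\<^sub>v x t))"
    by simp
  also have "\<dots> = (\<Sum>k<n. \<Sum>i<n. c $ k * (U $$ (k, i) * (row W i \<bullet> x t)))"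
    using U W c by (auto simp: scalar_prod_def[of c] scalar_prod_def[of "row U _"]
        atLeast0LessThan sum_distrib_left intro!: sum.cong)
  also have "\<dots> = (\<Sum>i<n. (c \<bullet> col U i) * (row W i \<bullet> x t))"
    using U c by (subst sum.swap) (auto simp: scalar_prod_def[of c] atLeast0LessThan
        sum_distrib_left sum_distrib_right mult_ac intro!: sum.cong)
  also have "\<dots> = (\<Sum>i<n. spectral_weight c U W x0 i * exp (- ev i * t))"
    by (intro sum.cong) (simp_all add: mode t x0 spectral_weight_def)
  finally show ?thesis .
qed

section \<open>Eigenvalues and the spectral measure\<close>

lemma diagonalized_eigenvalue:
  fixes ev :: "nat \<Rightarrow> 'a :: field"
  assumes U: "U \<in> carrier_mat n n" and W: "W \<in> carrier_mat n n"
    and WU: "W * U = 1\<^sub>m n" and i: "i < n"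
  shows "eigenvalue (U * mat_diag n ev * W) (ev i)"
proof -
  let ?A = "U * mat_diag n ev * W"
  have D: "U * mat_diag n ev \<in> carrier_mat n n"
    using U by simp
  have A: "?A \<in> carrier_mat n n"
    using D W by simp
  have AU: "?A * U = U * mat_diag n ev"
    using assoc_mult_mat[OF D W U] by (simp add: WU right_mult_one_mat[OF D])
  have "?A *\<^sub>v col U i = col (?A * U) i"
    using col_mult2[OF A U i] by simp
  also have "\<dots> = col (U * mat_diag n ev) i"
    by (simp only: AU)
  also have "\<dots> = ev i \<cdot>\<^sub>v col U i"
    unfolding mat_diag_mult_right[OF U] using U i by (intro eq_vecI) auto
  finally have eig: "?A *\<^sub>v col U i = ev i \<cdot>\<^sub>v col U i" .
  \<comment> \<open>A zero column of \<open>U\<close> would put a zero on the diagonal of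
    \<open>W * U\<close>, which is the identity.\<close>
  have "col U i \<noteq> 0\<^sub>v n"
  proof
    assume "col U i = 0\<^sub>v n"
    then have "(W * U) $$ (i, i) = 0"
      using U W i by simp
    then show False
      using i by (simp add: WU)
  qed
  then show ?thesis
    using eig U A by (auto simp: eigenvalue_def eigenvector_def intro!: exI[of _ "col U i"])
qed

text \<open>Collecting equal exponentials passes from a sum over indices to one over distinct atoms;
  atoms whose weights cancel drop out.\<close>

lemma spectral_moments_eq_sum_support:
  fixes \<omega> ev :: "nat \<Rightarrow> real" and n :: nat
  assumes \<tau>: "\<tau> > 0"
  defines "mass \<equiv> \<lambda>z. \<Sum>j | j < n \<and> exp (- ev j * \<tau>) = z. \<omega> j"
  shows "(\<Sum>i<n. \<omega> i * exp (- ev i * \<tau>) ^ k) = (\<Sum>z\<in>spectral_support n ev \<omega> \<tau>. mass z * z ^ k)"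
    and "z \<in> spectral_support n ev \<omega> \<tau> \<Longrightarrow> mass z \<noteq> 0"
    and "finite (spectral_support n ev \<omega> \<tau>)"
    and "card (spectral_support n ev \<omega> \<tau>) \<le> n"
proof -
  let ?e = "\<lambda>i. exp (- ev i * \<tau>)" and ?S = "spectral_support n ev \<omega> \<tau>"
  \<comment> \<open>Because \<open>\<tau> > 0\<close>, two exponentials agree only if the
    eigenvalues do.\<close>
  have mass: "mass (?e i) = (\<Sum>j | j < n \<and> ev j = ev i. \<omega> j)" for i
    unfolding mass_def using \<tau> by (intro sum.cong) auto
  have S: "?S = {z \<in> ?e ` {..<n}. mass z \<noteq> 0}"
    unfolding spectral_support_def using mass by auto
  show "z \<in> ?S \<Longrightarrow> mass z \<noteq> 0" "finite ?S"
    by (auto simp: S)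
  have "card ?S \<le> card (?e ` {..<n})"
    unfolding S by (intro card_mono) auto
  also have "\<dots> \<le> card {..<n}"
    by (intro card_image_le) simp
  finally show "card ?S \<le> n"
    by simp
  have "(\<Sum>i<n. \<omega> i * ?e i ^ k) = (\<Sum>z\<in>?e ` {..<n}. \<Sum>i\<in>{i \<in> {..<n}. ?e i = z}. \<omega> i * ?e i ^ k)"
    by (rule sum.image_gen) simp
  also have "\<dots> = (\<Sum>z\<in>?e ` {..<n}. mass z * z ^ k)"
    unfolding mass_def sum_distrib_right by (intro sum.cong refl) auto
  also have "\<dots> = (\<Sum>z\<in>?S. mass z * z ^ k)"
    by (intro sum.mono_neutral_right) (auto simp: S)
  finally show "(\<Sum>i<n. \<omega> i * ?e i ^ k) = (\<Sum>z\<in>?S. mass z * z ^ k)" .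
qed

section \<open>Laplacian samples as moments of the spectral measure\<close>

theorem mainTheorem4:
  fixes n :: nat
    and G :: "(nat, 'e) pre_digraph"
    and L U W :: "real mat"
    and ev \<omega> :: "nat \<Rightarrow> real"
    and c x0 :: "real vec"
    and \<tau> :: real
    and x :: "real \<Rightarrow> real vec"
    and y :: "real \<Rightarrow> real"
    and ys :: "nat \<Rightarrow> real"
    and r :: nat
  assumes graph: "graph G" "verts G = {..<n}"
    and L: "L = laplacian_mat n G"
    and U: "U \<in> carrier_mat n n"
    and W: "W = transpose_mat U" "inverts_mat U W" "inverts_mat W U"
    and diagonalization: "L = U * mat_diag n ev * W"
    and c: "c \<in> carrier_vec n"
    and x0: "x0 \<in> carrier_vec n"
    and \<tau>: "\<tau> > 0"
    and weights: "\<And>i. i < n \<Longrightarrow> \<omega> i = spectral_weight c U W x0 i"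
    and state: "solves_linear_ode n (- L) x0 x"
    and measured: "\<And>t. t \<ge> 0 \<Longrightarrow> y t = c \<bullet> x t"
    and samples: "\<And>k. k < 2 * n \<Longrightarrow> ys k = y (real k * \<tau>)"
    and r: "r = vec_space.rank n (hankel_mat n ys)"
  shows "invertible_mat (hankel_mat r ys) \<and>
    (\<forall>z \<in> spectral_support n ev \<omega> \<tau>.
       poly (hankel_poly r ys) z = 0 \<and>
       (\<forall>i<n. z = exp (- ev i * \<tau>) \<longrightarrow> eigenvalue L (ev i) \<and> ev i = - (1 / \<tau>) * ln z))"
proof -
  let ?S = "spectral_support n ev \<omega> \<tau>"
  define mass where "mass z = (\<Sum>j | j < n \<and> exp (- ev j * \<tau>) = z. \<omega> j)" for z
  note support = spectral_moments_eq_sum_support[OF \<tau>, where \<omega> = \<omega> and ev = ev and n = n, folded mass_def]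
  have Wc: "W \<in> carrier_mat n n"
    using U W(1) by simp
  have UW: "U * W = 1\<^sub>m n" and WU: "W * U = 1\<^sub>m n"
    using W(2,3) U Wc by (auto simp: inverts_mat_def)
  have ys: "ys k = (\<Sum>z\<in>?S. mass z * z ^ k)" if k: "k < 2 * n" for k
  proof -
    have "ys k = c \<bullet> x (real k * \<tau>)"
      using k \<tau> by (simp add: samples measured)
    also have "\<dots> = (\<Sum>i<n. spectral_weight c U W x0 i * exp (- ev i * (real k * \<tau>)))"
      using diagonalized_ode_solution[OF U Wc UW WU state[unfolded diagonalization] c] \<tau> by simp
    \<comment> \<open>Equidistant sampling turns the exponentials into \<open>k\<close>-th powers of
      fixed nodes.\<close>
    also have "\<dots> = (\<Sum>i<n. \<omega> i * exp (- ev i * \<tau>) ^ k)"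
      by (intro sum.cong) (auto simp: weights exp_of_nat_mult[symmetric] mult_ac)
    finally show ?thesis
      by (simp only: support(1))
  qed
  have r_card: "r = card ?S"
    unfolding r using support ys by (intro rank_hankel_mat_moments[where m = mass]) auto
  \<comment> \<open>The support has at most \<open>n\<close> points, so these indices stay within
    the available samples.\<close>
  have ys': "ys k = (\<Sum>z\<in>?S. mass z * z ^ k)" if "k < 2 * card ?S" for k
    using that support(4) by (intro ys) simp
  have "det (hankel_mat r ys) \<noteq> 0"
    unfolding r_card using det_hankel_mat_moments_nonzero[OF support(3,2) ys'] .
  then obtain B where "hankel_mat r ys * B = 1\<^sub>m r" "B * hankel_mat r ys = 1\<^sub>m r" "B \<in> carrier_mat r r"
    using det_nonzero_mat_inverse[OF hankel_mat_carrier] by metis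
  then have "invertible_mat (hankel_mat r ys)"
    by (auto simp: invertible_mat_def inverts_mat_def hankel_mat_def)
  moreover have "poly (hankel_poly r ys) z = 0" if "z \<in> ?S" for z
    unfolding r_card using hankel_poly_moments_root[OF support(3,2) ys' that] .
  moreover have "eigenvalue L (ev i)" if "i < n" for i
    unfolding diagonalization using diagonalized_eigenvalue[OF U Wc WU that] .
  moreover have "ev i = - (1 / \<tau>) * ln (exp (- ev i * \<tau>))" for i
    using \<tau> by simp
  ultimately show ?thesis
    by blast
qed

end
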